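(* Let $n\ge 1$ be a positive integer. The minimal isometric dilation of any non-unitary contraction in $\mathfrak{L}_n$ is a shift.
   Context: Let $\mathcal{F}_n$ be the unital free semigroup on $n$ generators $z_1,\dots,z_n$ (its unit is the empty word $1$), and let $\mathcal{H}_n=\ell_2(\mathcal{F}_n)$, with orthonormal basis $\{\xi_w: w\in\mathcal{F}_n\}$. Let $L_i$ be the isometry on $\mathcal{H}_n$ with $L_i\xi_v=\xi_{z_iv}$. The non-commutative analytic Toeplitz algebra $\mathfrak{L}_n$ is the unital algebra, closed in the weak operator topology, generated by $L_1,\dots,L_n$ in $\mathcal{B}(\mathcal{H}_n)$. The minimal isometric dilation of a contraction $T\in\mathcal{B}(\mathcal{H})$ is the (unique up to unitary equivalence fixing $\mathcal{H}$) isometry $V$ on a Hilbert space $\mathcal{K}\supseteq\mathcal{H}$ such that $T^k=P_{\mathcal{H}}V^k|_{\mathcal{H}}$ for all $k\ge 0$ and $\mathcal{K}$ is the closed linear span of $\bigcup_{k\ge 0}V^k\mathcal{H}$. By the Wold decomposition, every isometry is the orthogonal direct sum of a unitary and copies of the unilateral shift; an isometry is called a shift if its unitary part is vacuous, i.e. it is unitarily equivalent to a direct sum of copies of the unilateral shift. *)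

theory Defs
  imports "HOL-Analysis.Analysis"
begin

section \<open>Complex Hilbert spaces\<close>

text \<open>The inner product is linear in the first argument. Positivity and definiteness are contained in
  the last axiom, and completeness in \<^class>\<open>banach\<close>.\<close>

class chilbert_space = banach +
  fixes scaleC :: "complex \<Rightarrow> 'a \<Rightarrow> 'a"  (infixr \<open>*\<^sub>C\<close> 75)
    and cinner :: "'a \<Rightarrow> 'a \<Rightarrow> complex"
  assumes scaleR_scaleC: "r *\<^sub>R x = complex_of_real r *\<^sub>C x"
    and scaleC_add_right: "a *\<^sub>C (x + y) = a *\<^sub>C x + a *\<^sub>C y"
    and scaleC_add_left: "(a + b) *\<^sub>C x = a *\<^sub>C x + b *\<^sub>C x"
    and scaleC_scaleC: "a *\<^sub>C b *\<^sub>C x = (a * b) *\<^sub>C x"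
    and scaleC_one: "1 *\<^sub>C x = x"
    and cinner_commute: "cinner x y = cnj (cinner y x)"
    and cinner_add_left: "cinner (x + y) z = cinner x z + cinner y z"
    and cinner_scaleC_left: "cinner (a *\<^sub>C x) y = a * cinner x y"
    and cinner_self: "cinner x x = complex_of_real ((norm x)\<^sup>2)"

global_interpretation complex_vector: vector_space "scaleC :: complex \<Rightarrow> 'a \<Rightarrow> 'a :: chilbert_space"
  defines cspan = complex_vector.span
  by standard (simp_all add: scaleC_add_right scaleC_add_left scaleC_scaleC scaleC_one)

definition clinear :: "('a::chilbert_space \<Rightarrow> 'b::chilbert_space) \<Rightarrow> bool" where
  "clinear f \<longleftrightarrow> Vector_Spaces.linear scaleC scaleC f"

definition bounded_clinear :: "('a::chilbert_space \<Rightarrow> 'b::chilbert_space) \<Rightarrow> bool" where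
  "bounded_clinear f \<longleftrightarrow> clinear f \<and> (\<exists>K. \<forall>x. norm (f x) \<le> norm x * K)"

definition contraction :: "('a::chilbert_space \<Rightarrow> 'b::chilbert_space) \<Rightarrow> bool" where
  "contraction T \<longleftrightarrow> bounded_clinear T \<and> onorm T \<le> 1"

definition isometry :: "('a::chilbert_space \<Rightarrow> 'b::chilbert_space) \<Rightarrow> bool" where
  "isometry V \<longleftrightarrow> clinear V \<and> (\<forall>x. norm (V x) = norm x)"

definition unitary :: "('a::chilbert_space \<Rightarrow> 'b::chilbert_space) \<Rightarrow> bool" where
  "unitary U \<longleftrightarrow> isometry U \<and> surj U"

definition weak_operator_topology :: "('a::chilbert_space \<Rightarrow> 'a) topology" where
  "weak_operator_topology =
     pullback_topology {T. bounded_clinear T} (\<lambda>T (x, y). cinner (T x) y) euclidean"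

text \<open>\<^term>\<open>p\<close> is the orthogonal projection of \<^term>\<open>x\<close> onto the subspace \<^term>\<open>M\<close>.\<close>

definition is_projection_onto :: "'a::chilbert_space set \<Rightarrow> 'a \<Rightarrow> 'a \<Rightarrow> bool" where
  "is_projection_onto M x p \<longleftrightarrow> p \<in> M \<and> (\<forall>m\<in>M. cinner (x - p) m = 0)"

text \<open>The containment of \<open>H\<close> in the dilation space \<open>K\<close> is given by an isometric embedding
  \<open>J\<close>, so \<open>P\<^sub>H V\<^sup>k\<close> restricted to \<open>H\<close> being \<open>T\<^sup>k\<close> says that
  \<open>J (T\<^sup>k x)\<close> is the projection of \<open>V\<^sup>k (J x)\<close> onto the range of \<open>J\<close>.\<close>

definition minimal_isometric_dilation ::
    "('h::chilbert_space \<Rightarrow> 'h) \<Rightarrow> ('h \<Rightarrow> 'k::chilbert_space) \<Rightarrow> ('k \<Rightarrow> 'k) \<Rightarrow> bool" where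
  "minimal_isometric_dilation T J V \<longleftrightarrow>
     isometry J \<and> isometry V \<and>
     (\<forall>k x. is_projection_onto (range J) ((V ^^ k) (J x)) (J ((T ^^ k) x))) \<and>
     closure (cspan (\<Union>k. (V ^^ k) ` range J)) = UNIV"


section \<open>The Hilbert space of square-summable families\<close>

typedef 'i ell2 = "{f :: 'i \<Rightarrow> complex. (\<lambda>i. (cmod (f i))\<^sup>2) summable_on UNIV}"
  morphisms coord Abs_ell2
  by (rule exI[of _ "\<lambda>_. 0"]) simp

setup_lifting type_definition_ell2

lemma square_summableI:
  assumes "\<And>F. finite F \<Longrightarrow> (\<Sum>i\<in>F. (cmod (f i))\<^sup>2) \<le> B"
  shows "(\<lambda>i. (cmod (f i))\<^sup>2) summable_on UNIV"
  by (rule nonneg_bdd_above_summable_on) (use assms in \<open>auto intro!: bdd_aboveI[of _ B]\<close>)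

lemma square_sum_le:
  assumes "(\<lambda>i. (cmod (f i))\<^sup>2) summable_on UNIV" "finite F"
  shows "(\<Sum>i\<in>F. (cmod (f i))\<^sup>2) \<le> (\<Sum>\<^sub>\<infinity>i. (cmod (f i))\<^sup>2)"
  by (rule finite_sum_le_infsum) (use assms in auto)

lemma square_summable_add:
  assumes "(\<lambda>i. (cmod (f i))\<^sup>2) summable_on UNIV" "(\<lambda>i. (cmod (g i))\<^sup>2) summable_on UNIV"
  shows "(\<lambda>i. (cmod (f i + g i))\<^sup>2) summable_on UNIV"
proof (rule square_summableI)
  fix F :: "'a set" assume "finite F"
  have *: "(cmod (a + b))\<^sup>2 \<le> 2 * (cmod a)\<^sup>2 + 2 * (cmod b)\<^sup>2" for a b
  proof -
    have "(cmod (a + b))\<^sup>2 \<le> (cmod a + cmod b)\<^sup>2"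
      by (intro power_mono norm_triangle_ineq norm_ge_zero)
    also have "\<dots> \<le> 2 * (cmod a)\<^sup>2 + 2 * (cmod b)\<^sup>2"
      using sum_squares_bound[of "cmod a" "cmod b"] by (simp add: power2_sum)
    finally show ?thesis .
  qed
  have "(\<Sum>i\<in>F. (cmod (f i + g i))\<^sup>2) \<le> (\<Sum>i\<in>F. 2 * (cmod (f i))\<^sup>2 + 2 * (cmod (g i))\<^sup>2)"
    by (intro sum_mono *)
  also have "\<dots> = 2 * (\<Sum>i\<in>F. (cmod (f i))\<^sup>2) + 2 * (\<Sum>i\<in>F. (cmod (g i))\<^sup>2)"
    by (simp add: sum.distrib sum_distrib_left)
  also have "\<dots> \<le> 2 * (\<Sum>\<^sub>\<infinity>i. (cmod (f i))\<^sup>2) + 2 * (\<Sum>\<^sub>\<infinity>i. (cmod (g i))\<^sup>2)"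
    using assms \<open>finite F\<close> by (intro add_mono mult_left_mono square_sum_le) auto
  finally show "(\<Sum>i\<in>F. (cmod (f i + g i))\<^sup>2)
      \<le> 2 * (\<Sum>\<^sub>\<infinity>i. (cmod (f i))\<^sup>2) + 2 * (\<Sum>\<^sub>\<infinity>i. (cmod (g i))\<^sup>2)" .
qed

lemma square_summable_scale:
  assumes "(\<lambda>i. (cmod (f i))\<^sup>2) summable_on UNIV"
  shows "(\<lambda>i. (cmod (c * f i))\<^sup>2) summable_on UNIV"
  using summable_on_cmult_right[OF assms, of "(cmod c)\<^sup>2"]
  by (simp add: norm_mult power_mult_distrib)

lemma square_summable_cinner:
  assumes "(\<lambda>i. (cmod (f i))\<^sup>2) summable_on UNIV" "(\<lambda>i. (cmod (g i))\<^sup>2) summable_on UNIV"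
  shows "(\<lambda>i. f i * cnj (g i)) summable_on UNIV"
proof (rule abs_summable_summable, rule summable_on_comparison_test)
  show "(\<lambda>i. (cmod (f i))\<^sup>2 + (cmod (g i))\<^sup>2) summable_on UNIV"
    by (intro summable_on_add assms)
  fix i
  show "cmod (f i * cnj (g i)) \<le> (cmod (f i))\<^sup>2 + (cmod (g i))\<^sup>2"
    using sum_squares_bound[of "cmod (f i)" "cmod (g i)"]
      mult_nonneg_nonneg[OF norm_ge_zero[of "f i"] norm_ge_zero[of "g i"]]
    unfolding norm_mult complex_mod_cnj by linarith
qed auto

instantiation ell2 :: (type) real_vector
begin
lift_definition zero_ell2 :: "'a ell2" is "\<lambda>_. 0" by simp
lift_definition plus_ell2 :: "'a ell2 \<Rightarrow> 'a ell2 \<Rightarrow> 'a ell2" is "\<lambda>f g i. f i + g i"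
  by (simp add: square_summable_add)
lift_definition uminus_ell2 :: "'a ell2 \<Rightarrow> 'a ell2" is "\<lambda>f i. - f i" by simp
lift_definition minus_ell2 :: "'a ell2 \<Rightarrow> 'a ell2 \<Rightarrow> 'a ell2" is "\<lambda>f g i. f i - g i"
  subgoal for f g using square_summable_add[of f "\<lambda>i. - g i"] by simp
  done
lift_definition scaleR_ell2 :: "real \<Rightarrow> 'a ell2 \<Rightarrow> 'a ell2" is "\<lambda>r f i. complex_of_real r * f i"
  by (rule square_summable_scale)
instance
  by standard (transfer; simp add: fun_eq_iff algebra_simps)+
end

instantiation ell2 :: (type) real_normed_vector
begin
lift_definition norm_ell2 :: "'a ell2 \<Rightarrow> real" is "\<lambda>f. sqrt (\<Sum>\<^sub>\<infinity>i. (cmod (f i))\<^sup>2)" .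
definition sgn_ell2 :: "'a ell2 \<Rightarrow> 'a ell2" where "sgn_ell2 f = f /\<^sub>R norm f"
definition dist_ell2 :: "'a ell2 \<Rightarrow> 'a ell2 \<Rightarrow> real" where "dist_ell2 f g = norm (f - g)"
definition uniformity_ell2 :: "('a ell2 \<times> 'a ell2) filter"
  where "uniformity_ell2 = (INF e\<in>{0 <..}. principal {(x, y). dist x y < e})"
definition open_ell2 :: "'a ell2 set \<Rightarrow> bool"
  where "open_ell2 S = (\<forall>x\<in>S. \<forall>\<^sub>F (x', y) in uniformity. x' = x \<longrightarrow> y \<in> S)"

lemma ell2_L2_set_le_norm: "finite F \<Longrightarrow> L2_set (\<lambda>i. cmod (coord f i)) F \<le> norm f"
  unfolding L2_set_def by transfer (auto intro: square_sum_le)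

lemma ell2_norm_le:
  assumes "\<And>F. finite F \<Longrightarrow> L2_set (\<lambda>i. cmod (coord f i)) F \<le> B"
  shows "norm f \<le> B"
proof -
  have "B \<ge> 0" using assms[of "{}"] by simp
  have "(\<Sum>i\<in>F. (cmod (coord f i))\<^sup>2) \<le> B\<^sup>2" if "finite F" for F
    using assms[OF that] unfolding L2_set_def by (rule sqrt_le_D)
  then have "(\<Sum>\<^sub>\<infinity>i. (cmod (coord f i))\<^sup>2) \<le> B\<^sup>2"
    by (intro infsum_le_finite_sums) (use coord[of f] in auto)
  then show ?thesis
    using \<open>B \<ge> 0\<close> by (simp add: norm_ell2.rep_eq real_le_lsqrt infsum_nonneg)
qed

lemma ell2_coord_le_norm: "cmod (coord f i) \<le> norm f"
  using ell2_L2_set_le_norm[of "{i}" f] by simp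

instance
proof
  fix f g :: "'a ell2" and r :: real
  show "norm f = 0 \<longleftrightarrow> f = 0"
  proof
    assume "norm f = 0"
    then have "coord f i = 0" for i
      using ell2_coord_le_norm[of f i] by simp
    then show "f = 0" by transfer auto
  qed (transfer, simp)
  show "norm (f + g) \<le> norm f + norm g"
  proof (rule ell2_norm_le)
    fix F :: "'a set" assume F: "finite F"
    have "L2_set (\<lambda>i. cmod (coord (f + g) i)) F
        \<le> L2_set (\<lambda>i. cmod (coord f i) + cmod (coord g i)) F"
      by (intro L2_set_mono) (auto simp: plus_ell2.rep_eq norm_triangle_ineq)
    also have "\<dots> \<le> L2_set (\<lambda>i. cmod (coord f i)) F + L2_set (\<lambda>i. cmod (coord g i)) F"
      by (rule L2_set_triangle_ineq)
    also have "\<dots> \<le> norm f + norm g"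
      by (intro add_mono ell2_L2_set_le_norm F)
    finally show "L2_set (\<lambda>i. cmod (coord (f + g) i)) F \<le> norm f + norm g" .
  qed
  show "norm (r *\<^sub>R f) = \<bar>r\<bar> * norm f"
    by transfer (simp add: norm_mult power_mult_distrib infsum_cmult_right' real_sqrt_mult)
qed (simp_all add: sgn_ell2_def dist_ell2_def uniformity_ell2_def open_ell2_def)
end

instance ell2 :: (type) banach
proof
  fix X :: "nat \<Rightarrow> 'a ell2" assume X: "Cauchy X"
  have "Cauchy (\<lambda>n. coord (X n) i)" for i
  proof (rule CauchyI)
    fix e :: real assume "e > 0"
    then obtain M where M: "\<forall>m\<ge>M. \<forall>n\<ge>M. norm (X m - X n) < e" using CauchyD[OF X] by blast
    have "cmod (coord (X m) i - coord (X n) i) \<le> norm (X m - X n)" for m n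
      using ell2_coord_le_norm[of "X m - X n" i] by (simp add: minus_ell2.rep_eq)
    then show "\<exists>M. \<forall>m\<ge>M. \<forall>n\<ge>M. cmod (coord (X m) i - coord (X n) i) < e"
      using M by (meson le_less_trans)
  qed
  then have "\<forall>i. \<exists>l. (\<lambda>n. coord (X n) i) \<longlonglongrightarrow> l"
    by (metis Cauchy_convergent convergent_def)
  then obtain l where l: "\<And>i. (\<lambda>n. coord (X n) i) \<longlonglongrightarrow> l i" by metis
  have close: "L2_set (\<lambda>i. cmod (l i - coord (X n) i)) F \<le> e"
    if "finite F" "\<forall>m\<ge>n. norm (X m - X n) \<le> e" for F n e
  proof (rule tendsto_upperbound)
    show "(\<lambda>m. L2_set (\<lambda>i. cmod (coord (X m) i - coord (X n) i)) F)
        \<longlonglongrightarrow> L2_set (\<lambda>i. cmod (l i - coord (X n) i)) F"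
      unfolding L2_set_def by (intro tendsto_intros l)
    show "\<forall>\<^sub>F m in sequentially. L2_set (\<lambda>i. cmod (coord (X m) i - coord (X n) i)) F \<le> e"
      using eventually_ge_at_top[of n]
    proof eventually_elim
      case (elim m)
      then have "norm (X m - X n) \<le> e" using that(2) by simp
      with ell2_L2_set_le_norm[OF that(1), of "X m - X n"] show ?case
        by (simp add: minus_ell2.rep_eq)
    qed
  qed simp
  have sq: "(\<lambda>i. (cmod (l i))\<^sup>2) summable_on UNIV"
  proof -
    obtain N where N: "\<forall>m\<ge>N. norm (X m - X N) < 1" using CauchyD[OF X, of 1] by auto
    have "(\<lambda>i. (cmod (l i - coord (X N) i))\<^sup>2) summable_on UNIV"
    proof (rule square_summableI)
      fix F :: "'a set" assume "finite F"
      then have "L2_set (\<lambda>i. cmod (l i - coord (X N) i)) F \<le> 1"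
        using N by (intro close) (auto intro: less_imp_le)
      then show "(\<Sum>i\<in>F. (cmod (l i - coord (X N) i))\<^sup>2) \<le> 1" by (simp add: L2_set_def)
    qed
    from square_summable_add[OF this, of "coord (X N)"] show ?thesis using coord[of "X N"] by simp
  qed
  define Y where "Y = Abs_ell2 l"
  have Y: "coord Y = l" unfolding Y_def using sq by (simp add: Abs_ell2_inverse)
  have "X \<longlonglongrightarrow> Y"
  proof (rule LIMSEQ_I)
    fix e :: real assume "e > 0"
    then obtain M where M: "\<forall>m\<ge>M. \<forall>n\<ge>M. norm (X m - X n) < e/2"
      using CauchyD[OF X, of "e/2"] by auto
    have "norm (X n - Y) < e" if "n \<ge> M" for n
    proof -
      have "\<forall>m\<ge>n. norm (X m - X n) \<le> e/2"
        using M that by (meson le_trans less_imp_le)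
      then have "norm (Y - X n) \<le> e/2"
        by (intro ell2_norm_le) (simp only: minus_ell2.rep_eq Y close)
      then show ?thesis using \<open>e > 0\<close> by (simp add: norm_minus_commute)
    qed
    then show "\<exists>M. \<forall>n\<ge>M. norm (X n - Y) < e" by blast
  qed
  then show "convergent X" by (auto simp: convergent_def)
qed

instantiation ell2 :: (type) chilbert_space
begin
lift_definition scaleC_ell2 :: "complex \<Rightarrow> 'a ell2 \<Rightarrow> 'a ell2" is "\<lambda>c f i. c * f i"
  by (rule square_summable_scale)
lift_definition cinner_ell2 :: "'a ell2 \<Rightarrow> 'a ell2 \<Rightarrow> complex" is
  "\<lambda>f g. \<Sum>\<^sub>\<infinity>i. f i * cnj (g i)" .
instance
proof
  fix f g h :: "'a ell2" and a b :: complex and r :: real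
  show "r *\<^sub>R f = complex_of_real r *\<^sub>C f" by transfer simp
  show "a *\<^sub>C (f + g) = a *\<^sub>C f + a *\<^sub>C g" by transfer (simp add: algebra_simps)
  show "(a + b) *\<^sub>C f = a *\<^sub>C f + b *\<^sub>C f" by transfer (simp add: algebra_simps)
  show "a *\<^sub>C b *\<^sub>C f = (a * b) *\<^sub>C f" by transfer (simp add: algebra_simps)
  show "1 *\<^sub>C f = f" by transfer simp
  show "cinner f g = cnj (cinner g f)"
    by transfer (simp add: mult.commute flip: infsum_cnj)
  show "cinner (f + g) h = cinner f h + cinner g h"
    by transfer (simp add: distrib_right infsum_add square_summable_cinner)
  show "cinner (a *\<^sub>C f) g = a * cinner f g"
    by transfer (simp add: mult.assoc infsum_cmult_right')
  show "cinner f f = complex_of_real ((norm f)\<^sup>2)"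
  proof transfer
    fix f :: "'a \<Rightarrow> complex" assume "(\<lambda>i. (cmod (f i))\<^sup>2) summable_on UNIV"
    then have "((\<lambda>i. complex_of_real ((cmod (f i))\<^sup>2)) has_sum
        complex_of_real (\<Sum>\<^sub>\<infinity>i. (cmod (f i))\<^sup>2)) UNIV"
      by (intro has_sum_of_real has_sum_infsum)
    then have "(\<Sum>\<^sub>\<infinity>i. f i * cnj (f i)) = complex_of_real (\<Sum>\<^sub>\<infinity>i. (cmod (f i))\<^sup>2)"
      unfolding complex_norm_square by (rule infsumI)
    then show "(\<Sum>\<^sub>\<infinity>i. f i * cnj (f i))
        = complex_of_real ((sqrt (\<Sum>\<^sub>\<infinity>i. (cmod (f i))\<^sup>2))\<^sup>2)"
      by (simp add: infsum_nonneg)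
  qed
qed
end

text \<open>\<open>\<ell>\<^sub>2(S)\<close> inside \<open>\<ell>\<^sub>2\<close> of the whole index type.\<close>

definition ell2_on :: "'i set \<Rightarrow> 'i ell2 set" where
  "ell2_on S = {f. \<forall>i. i \<notin> S \<longrightarrow> coord f i = 0}"

lift_definition ket :: "'i \<Rightarrow> 'i ell2"  (\<open>\<xi>\<close>) is "\<lambda>i j. if j = i then 1 else 0"
  by (rule finite_nonzero_values_imp_summable_on) simp

lemma cinner_ket: "cinner (\<xi> i) (\<xi> j) = (if i = j then 1 else 0)"
proof -
  have "cinner (\<xi> i) (\<xi> j) = (\<Sum>\<^sub>\<infinity>k\<in>{i}. if i = j then 1 else 0 :: complex)"
    unfolding cinner_ell2.rep_eq ket.rep_eq by (rule infsum_cong_neutral) auto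
  then show ?thesis by simp
qed


section \<open>Shifts\<close>

text \<open>For a set \<open>I\<close> of indices, the restriction of \<^term>\<open>shift_copies\<close> to
  \<^term>\<open>ell2_on (I \<times> UNIV)\<close> is the direct sum of \<open>I\<close> copies of the unilateral shift
  on \<open>\<ell>\<^sub>2(\<nat>)\<close>.\<close>

lemma square_summable_push:
  assumes "(\<lambda>i. (cmod (f i))\<^sup>2) summable_on UNIV" "inj h"
    and "\<And>i. g (h i) = f i" and "\<And>j. j \<notin> range h \<Longrightarrow> g j = 0"
  shows "(\<lambda>j. (cmod (g j))\<^sup>2) summable_on UNIV"
    and "(\<Sum>\<^sub>\<infinity>j. (cmod (g j))\<^sup>2) = (\<Sum>\<^sub>\<infinity>i. (cmod (f i))\<^sup>2)"
proof -
  have "(\<lambda>j. (cmod (g j))\<^sup>2) summable_on range h"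
    using assms by (subst summable_on_reindex) (auto simp: o_def)
  then show "(\<lambda>j. (cmod (g j))\<^sup>2) summable_on UNIV"
    by (rule summable_on_cong_neutral[THEN iffD1, rotated -1]) (use assms in auto)
  have "(\<Sum>\<^sub>\<infinity>j. (cmod (g j))\<^sup>2) = (\<Sum>\<^sub>\<infinity>j\<in>range h. (cmod (g j))\<^sup>2)"
    by (rule infsum_cong_neutral) (use assms in auto)
  also have "\<dots> = (\<Sum>\<^sub>\<infinity>i. (cmod (f i))\<^sup>2)"
    using assms by (subst infsum_reindex) (auto simp: o_def)
  finally show "(\<Sum>\<^sub>\<infinity>j. (cmod (g j))\<^sup>2) = (\<Sum>\<^sub>\<infinity>i. (cmod (f i))\<^sup>2)" .
qed

lift_definition shift_copies :: "('i \<times> nat) ell2 \<Rightarrow> ('i \<times> nat) ell2" is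
  "\<lambda>f (i, k). (case k of 0 \<Rightarrow> 0 | Suc m \<Rightarrow> f (i, m))"
proof -
  fix f :: "'i \<times> nat \<Rightarrow> complex" assume "(\<lambda>i. (cmod (f i))\<^sup>2) summable_on UNIV"
  then show "(\<lambda>p. (cmod (case p of (i, k) \<Rightarrow> (case k of 0 \<Rightarrow> 0 | Suc m \<Rightarrow> f (i, m))))\<^sup>2) summable_on UNIV"
    by (rule square_summable_push(1)[where h = "\<lambda>(i, k). (i, Suc k)"])
      (auto simp: inj_def image_iff split: nat.split)
qed

lemma shift_copies_ket: "shift_copies (\<xi> (i, k)) = \<xi> (i, Suc k)"
  by transfer (auto simp: fun_eq_iff split: nat.split)

text \<open>The number of copies cannot exceed the (Hilbert) dimension of the space, so index sets
  \<open>I\<close> inside the type \<^typ>\<open>'k\<close> of the space suffice.\<close>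

definition is_shift :: "('k::chilbert_space \<Rightarrow> 'k) \<Rightarrow> bool" where
  "is_shift V \<longleftrightarrow> (\<exists>(I :: 'k set) (U :: 'k \<Rightarrow> ('k \<times> nat) ell2).
     isometry U \<and> range U = ell2_on (I \<times> UNIV) \<and> (\<forall>x. U (V x) = shift_copies (U x)))"


section \<open>The non-commutative analytic Toeplitz algebra\<close>

text \<open>The free semigroup on the generators \<^typ>\<open>'n\<close> is \<^typ>\<open>'n list\<close> with concatenation.\<close>

lift_definition left_creation :: "'n \<Rightarrow> 'n list ell2 \<Rightarrow> 'n list ell2" is
  "\<lambda>i f w. case w of [] \<Rightarrow> 0 | j # v \<Rightarrow> if j = i then f v else 0"
proof -
  fix i and f :: "'n list \<Rightarrow> complex" assume "(\<lambda>i. (cmod (f i))\<^sup>2) summable_on UNIV"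
  then show "(\<lambda>w. (cmod (case w of [] \<Rightarrow> 0 | j # v \<Rightarrow> if j = i then f v else 0))\<^sup>2) summable_on UNIV"
    by (rule square_summable_push(1)[where h = "\<lambda>v. i # v"])
      (auto simp: inj_def image_iff split: list.split)
qed

lemma left_creation_ket: "left_creation i (\<xi> v) = \<xi> (i # v)"
  by transfer (auto simp: fun_eq_iff split: list.split)

lemma isometry_left_creation: "isometry (left_creation i)"
proof -
  have "norm (left_creation i f) = norm f" for f
    by transfer (rule arg_cong[where f = sqrt],
      rule square_summable_push(2)[where h = "\<lambda>v. i # v" for i],
      auto simp: inj_def image_iff split: list.split)
  moreover have "clinear (left_creation i)"
    unfolding clinear_def
    by unfold_locales (transfer; auto simp: fun_eq_iff split: list.split)+
  ultimately show ?thesis by (simp add: isometry_def)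
qed

definition unital_subalgebra :: "('a::chilbert_space \<Rightarrow> 'a) set \<Rightarrow> bool" where
  "unital_subalgebra A \<longleftrightarrow>
     A \<subseteq> {T. bounded_clinear T} \<and> id \<in> A \<and>
     (\<forall>S\<in>A. \<forall>T\<in>A. (\<lambda>x. S x + T x) \<in> A) \<and>
     (\<forall>c. \<forall>T\<in>A. (\<lambda>x. c *\<^sub>C T x) \<in> A) \<and>
     (\<forall>S\<in>A. \<forall>T\<in>A. S \<circ> T \<in> A)"

definition nc_toeplitz :: "('n list ell2 \<Rightarrow> 'n list ell2) set" where
  "nc_toeplitz =
     (\<lambda>A. unital_subalgebra A \<and> closedin weak_operator_topology A) hull range left_creation"

end

theory Submission
  imports Defs
begin

text \<open>
  Write \<open>a\<^sub>w\<close> for the coordinates of \<open>T \<xi>\<^bsub>[]\<^esub>\<close>. Left multiplication commutes with right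
  multiplication, so every \<open>T\<close> in the algebra commutes with the right creation operators; the
  commutant of these operators is a unital subalgebra that is closed in the weak operator topology. Therefore
  \<open>T\<close> acts as convolution by \<open>a\<close> from the left (\<open>coord_left_multiplier\<close>):
  the \<open>w\<close>-coordinate of \<open>T y\<close> is the sum of \<open>a\<^sub>u y\<^sub>v\<close> over the factorizations \<open>w = u v\<close>.
  Thus the adjoint of \<open>T\<close> is triangular with respect to word length, with the conjugate of the constant term
  \<open>a\<^bsub>[]\<^esub>\<close> everywhere on the diagonal.

  If \<open>T\<close> is a contraction, then \<open>T \<xi>\<^bsub>[]\<^esub>\<close> has norm at most one, hence
  \<open>a\<^bsub>[]\<^esub>\<close> has modulus at most one. If \<open>a\<^bsub>[]\<^esub>\<close> is unimodular, all
  other coefficients vanish and \<open>T\<close> is a unimodular scalar, hence unitary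
  (\<open>unimodular_left_multiplier_unitary\<close>). Otherwise the diagonal has modulus less than one, and
  induction on the length of \<open>w\<close> shows that the \<open>w\<close>-coordinate of \<open>T\<^sup>k h\<close> tends to zero
  uniformly for \<open>h\<close> in the unit ball
  (\<open>coord_left_multiplier_power_le\<close>, \<open>decay_bound_tendsto_zero\<close>). In other words, the powers of the adjoint
  of \<open>T\<close> tend strongly to zero.

  For any operator with this property, no nonzero vector lies in the range of all powers of the
  minimal isometric dilation (\<open>dilation_is_shift\<close>), and an isometry of that kind is a shift by the Wold
  decomposition (\<open>isometry_is_shift\<close>). The latter rests on orthonormal families in an abstract complex Hilbert
  space: Bessel's inequality, the Riesz--Fischer theorem (\<open>coefficients_closed_span\<close>) and the projection
  onto a closed subspace (\<open>projection_exists\<close>).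
\<close>


section \<open>Inner products\<close>

lemma cinner_add_right: "cinner x (y + z) = cinner x y + cinner x z"
  by (metis cinner_add_left cinner_commute complex_cnj_add)

lemma cinner_scaleC_right: "cinner x (c *\<^sub>C y) = cnj c * cinner x y"
  by (metis cinner_commute cinner_scaleC_left complex_cnj_mult)

lemma cinner_zero_left [simp]: "cinner 0 x = 0"
  using cinner_add_left[of 0 0 x] by simp

lemma cinner_zero_right [simp]: "cinner x 0 = 0"
  using cinner_add_right[of x 0 0] by simp

lemma cinner_diff_left: "cinner (x - y) z = cinner x z - cinner y z"
  using cinner_add_left[of "x - y" y z] by simp

lemma cinner_sum_left: "cinner (sum f F) y = (\<Sum>i\<in>F. cinner (f i) y)"
  by (induction F rule: infinite_finite_induct) (simp_all add: cinner_add_left)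

lemma cinner_eq_zero_commute: "cinner x y = 0 \<longleftrightarrow> cinner y x = 0"
  by (metis cinner_commute complex_cnj_zero)

lemma cinner_self_eq_zero [simp]: "cinner x x = 0 \<longleftrightarrow> x = 0"
  by (simp add: cinner_self)

lemma norm_scaleC: "norm (c *\<^sub>C x) = cmod c * norm x"
proof -
  have "cinner (c *\<^sub>C x) (c *\<^sub>C x) = c * cnj c * cinner x x"
    by (simp add: cinner_scaleC_left cinner_scaleC_right)
  then have "complex_of_real ((norm (c *\<^sub>C x))\<^sup>2) = complex_of_real ((cmod c * norm x)\<^sup>2)"
    unfolding cinner_self power_mult_distrib of_real_mult complex_norm_square[of c] .
  then have "(norm (c *\<^sub>C x))\<^sup>2 = (cmod c * norm x)\<^sup>2"
    using of_real_eq_iff by blast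
  then show ?thesis by (simp add: power2_eq_iff_nonneg)
qed

lemma pythagoras:
  assumes "cinner x y = 0"
  shows "(norm (x + y))\<^sup>2 = (norm x)\<^sup>2 + (norm y)\<^sup>2"
proof -
  have "cinner (x + y) (x + y) = cinner x x + cinner y y"
    using assms cinner_eq_zero_commute[of x y] by (simp add: cinner_add_left cinner_add_right)
  then have "complex_of_real ((norm (x + y))\<^sup>2) = complex_of_real ((norm x)\<^sup>2 + (norm y)\<^sup>2)"
    by (simp add: cinner_self)
  then show ?thesis using of_real_eq_iff by blast
qed


section \<open>Orthonormal families\<close>

definition orthonormal :: "('i \<Rightarrow> 'a::chilbert_space) \<Rightarrow> 'i set \<Rightarrow> bool" where
  "orthonormal e S \<longleftrightarrow> (\<forall>i\<in>S. \<forall>j\<in>S. cinner (e i) (e j) = (if i = j then 1 else 0))"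

text \<open>The sum on the left is the squared norm of the component \<open>p\<close> of \<open>x\<close> in the span of the family,
  and \<open>x - p\<close> is orthogonal to \<open>p\<close>.\<close>

lemma bessel:
  assumes "orthonormal e F" "finite F"
  shows "(\<Sum>i\<in>F. (cmod (cinner x (e i)))\<^sup>2) \<le> (norm x)\<^sup>2"
proof -
  define p where "p = (\<Sum>i\<in>F. cinner x (e i) *\<^sub>C e i)"
  have p_e: "cinner p (e j) = cinner x (e j)" if "j \<in> F" for j
  proof -
    have "cinner p (e j) = (\<Sum>i\<in>F. if i = j then cinner x (e i) else 0)"
      unfolding p_def cinner_sum_left cinner_scaleC_left
      using assms(1) that by (intro sum.cong) (auto simp: orthonormal_def)
    then show ?thesis using that assms(2) by simp
  qed
  have p_any: "cinner p y = (\<Sum>i\<in>F. cinner x (e i) * cinner (e i) y)" for y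
    unfolding p_def cinner_sum_left cinner_scaleC_left ..
  have "cinner (x - p) (e i) = 0" if "i \<in> F" for i
    using p_e[OF that] by (simp add: cinner_diff_left)
  then have "cinner (e i) (x - p) = 0" if "i \<in> F" for i
    using that cinner_eq_zero_commute by blast
  then have "cinner p (x - p) = 0"
    unfolding p_any by (intro sum.neutral) auto
  then have "(norm x)\<^sup>2 = (norm p)\<^sup>2 + (norm (x - p))\<^sup>2"
    using pythagoras[of p "x - p"] by simp
  moreover have "cinner (e i) p = cnj (cinner x (e i))" if "i \<in> F" for i
    using p_e[OF that] by (metis cinner_commute)
  then have "cinner p p = (\<Sum>i\<in>F. cinner x (e i) * cnj (cinner x (e i)))"
    unfolding p_any[of p] by (intro sum.cong) simp_all
  then have "complex_of_real ((norm p)\<^sup>2)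
      = complex_of_real (\<Sum>i\<in>F. (cmod (cinner x (e i)))\<^sup>2)"
    unfolding of_real_sum complex_norm_square cinner_self .
  then have "(norm p)\<^sup>2 = (\<Sum>i\<in>F. (cmod (cinner x (e i)))\<^sup>2)"
    using of_real_eq_iff by blast
  ultimately show ?thesis by simp
qed

lemma cinner_normalized:
  assumes "(y :: 'a::chilbert_space) \<noteq> 0"
  shows "cinner (complex_of_real (1 / norm y) *\<^sub>C y) (complex_of_real (1 / norm y) *\<^sub>C y) = 1"
  using assms by (simp add: cinner_self norm_scaleC norm_divide)

text \<open>Bessel's inequality for the family that consists of the unit vector \<open>y / \<parallel>y\<parallel>\<close>.\<close>

lemma cauchy_schwarz: "cmod (cinner x y) \<le> norm x * norm y"
proof (cases "y = 0")
  case False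
  define u where "u = complex_of_real (1 / norm y) *\<^sub>C y"
  have "orthonormal (\<lambda>_. u) {()}"
    unfolding orthonormal_def u_def using cinner_normalized[OF False] by simp
  from bessel[OF this, of x] have "cmod (cinner x u) \<le> norm x"
    by (simp add: power2_le_iff_abs_le)
  moreover have "cmod (cinner x u) = cmod (cinner x y) / norm y"
    by (simp add: u_def cinner_scaleC_right norm_divide)
  ultimately show ?thesis
    using False by (simp add: field_simps)
qed simp

lemma bounded_linear_cinner_left: "bounded_linear (\<lambda>x. cinner x y)"
  by (rule bounded_linear_intro[where K = "norm y"])
    (simp_all add: cinner_add_left scaleR_scaleC cinner_scaleC_left scaleR_conv_of_real cauchy_schwarz)

lemma bounded_linear_cinner_right: "bounded_linear (\<lambda>y. cinner x y)"
proof (rule bounded_linear_intro[where K = "norm x"])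
  show "norm (cinner x y) \<le> norm y * norm x" for y
    using cauchy_schwarz[of x y] by (simp add: mult.commute)
qed (simp_all add: cinner_add_right scaleR_scaleC cinner_scaleC_right scaleR_conv_of_real)

lemmas continuous_on_cinner_left [continuous_intros] =
  bounded_linear.continuous_on[OF bounded_linear_cinner_left]
lemmas continuous_on_cinner_right [continuous_intros] =
  bounded_linear.continuous_on[OF bounded_linear_cinner_right]

section \<open>Bounded linear maps and isometries\<close>

lemma clinearI:
  assumes "\<And>x y. f (x + y) = f x + f y" "\<And>c x. f (c *\<^sub>C x) = c *\<^sub>C f x"
  shows "clinear f"
  unfolding clinear_def by unfold_locales (use assms in auto)

lemma clinear_add: "clinear f \<Longrightarrow> f (x + y) = f x + f y"
  unfolding clinear_def by (simp add: Vector_Spaces.linear_iff)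

lemma clinear_scaleC: "clinear f \<Longrightarrow> f (c *\<^sub>C x) = c *\<^sub>C f x"
  unfolding clinear_def by (simp add: Vector_Spaces.linear_iff)

lemma clinear_0: "clinear f \<Longrightarrow> f 0 = 0"
  using clinear_scaleC[of f 0 0] by simp

lemma clinear_diff: "clinear f \<Longrightarrow> f (x - y) = f x - f y"
  using clinear_add[of f "x - y" y] by simp

lemma clinear_funpow:
  fixes f :: "'a::chilbert_space \<Rightarrow> 'a"
  shows "clinear f \<Longrightarrow> clinear (f ^^ k)"
  by (induction k) (auto intro!: clinearI simp: clinear_add clinear_scaleC)

lemma bounded_clinearI:
  assumes "clinear f" "bounded_linear f"
  shows "bounded_clinear f"
  using assms bounded_linear.bounded by (auto simp: bounded_clinear_def)

lemma bounded_clinear_imp_bounded_linear: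
  assumes "bounded_clinear f"
  shows "bounded_linear f"
proof -
  from assms have "clinear f" by (simp add: bounded_clinear_def)
  moreover obtain K where "\<And>x. norm (f x) \<le> norm x * K"
    using assms by (auto simp: bounded_clinear_def)
  ultimately show ?thesis
    by (intro bounded_linear_intro[where K = K]) (simp_all add: clinear_add clinear_scaleC scaleR_scaleC)
qed

lemma isometry_imp_bounded_linear: "isometry f \<Longrightarrow> bounded_linear f"
  by (rule bounded_clinear_imp_bounded_linear)
    (auto simp: isometry_def bounded_clinear_def intro!: exI[of _ 1])

lemma isometry_funpow:
  fixes V :: "'a::chilbert_space \<Rightarrow> 'a"
  assumes "isometry V"
  shows "isometry (V ^^ k)"
proof -
  have "norm ((V ^^ k) x) = norm x" for x
    using assms by (induction k) (simp_all add: isometry_def)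
  then show ?thesis
    using assms clinear_funpow by (auto simp: isometry_def)
qed

text \<open>Polarization: norms determine the real part of the inner product, and replacing \<open>x\<close> by
  \<open>\<i> x\<close> gives the imaginary part.\<close>

lemma isometry_cinner:
  assumes "isometry V"
  shows "cinner (V x) (V y) = cinner x y"
proof -
  have Re: "Re (cinner x y) = ((norm (x + y))\<^sup>2 - (norm x)\<^sup>2 - (norm y)\<^sup>2) / 2"
    for x y :: "'c::chilbert_space"
  proof -
    have "cinner (x + y) (x + y) = cinner x x + cinner y y + (cinner x y + cnj (cinner x y))"
      using cinner_commute[of y x] by (simp add: cinner_add_left cinner_add_right)
    from arg_cong[OF this, of Re] show ?thesis by (simp add: cinner_self)
  qed
  have Re_eq: "Re (cinner (V x) (V y)) = Re (cinner x y)" for x y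
    unfolding Re using assms by (simp add: isometry_def flip: clinear_add)
  have "Re (cinner (\<i> *\<^sub>C V x) (V y)) = Re (cinner (\<i> *\<^sub>C x) y)"
    using Re_eq[of "\<i> *\<^sub>C x" y] assms by (simp add: isometry_def clinear_scaleC)
  then show ?thesis
    using Re_eq[of x y] by (intro complex_eqI) (simp_all add: cinner_scaleC_left)
qed

lemma bounded_linear_scaleC: "bounded_linear (\<lambda>x. c *\<^sub>C x)"
  by (rule bounded_linear_intro[where K = "cmod c"])
    (simp_all add: scaleC_add_right scaleR_scaleC scaleC_scaleC norm_scaleC mult.commute)

lemma subspace_imp_real_subspace: "complex_vector.subspace M \<Longrightarrow> subspace M"
  unfolding complex_vector.subspace_def subspace_def by (auto simp: scaleR_scaleC)

lemma clinear_subspace_image: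
  assumes "clinear f" "complex_vector.subspace M"
  shows "complex_vector.subspace (f ` M)"
  using assms unfolding clinear_def
  by (metis module_hom.subspace_image module_hom_iff_linear)

lemma closure_complex_subspace:
  assumes "complex_vector.subspace M"
  shows "complex_vector.subspace (closure M)"
  unfolding complex_vector.subspace_def
proof (intro conjI ballI allI)
  show "0 \<in> closure M"
    using assms closure_subset[of M] unfolding complex_vector.subspace_def by blast
  show "x + y \<in> closure M" if "x \<in> closure M" "y \<in> closure M" for x y
  proof -
    obtain f g where "\<And>n. f n \<in> M" "f \<longlonglongrightarrow> x" "\<And>n. g n \<in> M" "g \<longlonglongrightarrow> y"
      using \<open>x \<in> closure M\<close> \<open>y \<in> closure M\<close> unfolding closure_sequential by blast
    then have "\<forall>n. f n + g n \<in> M" "(\<lambda>n. f n + g n) \<longlonglongrightarrow> x + y"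
      using complex_vector.subspace_add[OF assms] by (auto intro: tendsto_add)
    then show ?thesis
      unfolding closure_sequential by (intro exI[of _ "\<lambda>n. f n + g n"] conjI)
  qed
  fix c x assume x: "x \<in> closure M"
  have "continuous_on (closure M) (\<lambda>x. c *\<^sub>C x)"
    by (rule linear_continuous_on[OF bounded_linear_scaleC])
  moreover have "(\<lambda>x. c *\<^sub>C x) ` M \<subseteq> closure M"
    using assms closure_subset[of M] unfolding complex_vector.subspace_def by blast
  ultimately show "c *\<^sub>C x \<in> closure M"
    using x image_closure_subset[of M "\<lambda>x. c *\<^sub>C x" "closure M"] by auto
qed

lemma closure_cspan_minimal:
  assumes "B \<subseteq> M" "complex_vector.subspace M" "closed M"
  shows "closure (cspan B) \<subseteq> M"
  using assms by (intro closure_minimal complex_vector.span_minimal)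


section \<open>Fourier coefficients with respect to an orthonormal family\<close>

lemma coord_eq_cinner_ket: "cinner f (\<xi> i) = coord f i"
proof -
  have "cinner f (\<xi> i) = (\<Sum>\<^sub>\<infinity>k\<in>{i}. coord f i)"
    unfolding cinner_ell2.rep_eq ket.rep_eq by (rule infsum_cong_neutral) auto
  then show ?thesis by simp
qed

lemma ell2_eqI: "(\<And>i. coord f i = coord g i) \<Longrightarrow> f = g"
  by (metis coord_inject ext)

lemma coord_sum: "coord (sum f F) i = (\<Sum>j\<in>F. coord (f j) i)"
  by (induction F rule: infinite_finite_induct) (simp_all add: plus_ell2.rep_eq zero_ell2.rep_eq)

text \<open>Truncating \<open>f\<close> to a finite set \<open>F\<close> of indices leaves an error of squared norm
  \<open>\<Sum>\<^sub>i |f\<^sub>i|\<^sup>2 - \<Sum>\<^sub>i\<^sub>\<in>\<^sub>F |f\<^sub>i|\<^sup>2\<close>, which is small for large \<open>F\<close>.\<close>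

lemma ell2_on_subset_closure_span_ket:
  fixes S :: "'i set"
  shows "ell2_on S \<subseteq> closure (cspan (\<xi> ` S))"
proof
  fix f :: "'i ell2" assume f: "f \<in> ell2_on S"
  let ?q = "\<lambda>i. (cmod (coord f i))\<^sup>2"
  have sm: "?q summable_on UNIV" using coord[of f] by simp
  show "f \<in> closure (cspan (\<xi> ` S))"
    unfolding closure_approachable
  proof (intro allI impI)
    fix r :: real assume "r > 0"
    then have "(r / 2)\<^sup>2 > 0" by simp
    moreover have "(sum ?q \<longlongrightarrow> infsum ?q UNIV) (finite_subsets_at_top UNIV)"
      using has_sum_infsum[OF sm] by (simp add: has_sum_def)
    ultimately have "\<forall>\<^sub>F F in finite_subsets_at_top UNIV. dist (sum ?q F) (infsum ?q UNIV) < (r / 2)\<^sup>2"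
      by (rule tendstoD[rotated])
    then obtain F where F: "finite F" "dist (sum ?q F) (infsum ?q UNIV) < (r / 2)\<^sup>2"
      unfolding eventually_finite_subsets_at_top by auto
    define g where "g = (\<Sum>i\<in>F \<inter> S. coord f i *\<^sub>C \<xi> i)"
    have "g \<in> cspan (\<xi> ` S)"
      unfolding g_def
      by (intro complex_vector.span_sum complex_vector.span_scale complex_vector.span_base) auto
    moreover have g: "coord (f - g) i = (if i \<in> F then 0 else coord f i)" for i
    proof -
      have "coord g i = (\<Sum>j\<in>F \<inter> S. if j = i then coord f j else 0)"
        unfolding g_def coord_sum scaleC_ell2.rep_eq ket.rep_eq by (intro sum.cong) auto
      then show ?thesis
        using F(1) f by (auto simp: minus_ell2.rep_eq ell2_on_def)
    qed
    have "norm (f - g) \<le> r / 2"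
    proof (rule ell2_norm_le)
      fix G :: "'i set" assume G: "finite G"
      have "(\<Sum>i\<in>G. (cmod (coord (f - g) i))\<^sup>2) = sum ?q (G - F)"
        unfolding g using G by (intro sum.mono_neutral_cong_right) auto
      also have "\<dots> = sum ?q (G \<union> F) - sum ?q F"
        using F(1) G sum_diff[of "G \<union> F" F ?q] by (simp add: Un_Diff)
      also have "\<dots> \<le> infsum ?q UNIV - sum ?q F"
        using square_sum_le[OF sm, of "G \<union> F"] F(1) G by simp
      also have "\<dots> \<le> (r / 2)\<^sup>2"
        using F(2) by (simp add: dist_real_def)
      finally show "L2_set (\<lambda>i. cmod (coord (f - g) i)) G \<le> r / 2"
        unfolding L2_set_def using \<open>r > 0\<close> by (intro real_le_lsqrt) (auto intro: sum_nonneg)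
    qed
    then have "dist g f < r"
      using \<open>r > 0\<close> by (simp add: dist_norm norm_minus_commute)
    ultimately show "\<exists>y\<in>cspan (\<xi> ` S). dist y f < r" by blast
  qed
qed

corollary closure_span_ket: "closure (cspan (range \<xi>)) = UNIV"
  using ell2_on_subset_closure_span_ket[of UNIV] by (auto simp: ell2_on_def)

definition coefficients :: "('i \<Rightarrow> 'a::chilbert_space) \<Rightarrow> 'i set \<Rightarrow> 'a \<Rightarrow> 'i ell2" where
  "coefficients e S x = Abs_ell2 (\<lambda>i. if i \<in> S then cinner x (e i) else 0)"

context
  fixes e :: "'i \<Rightarrow> 'a::chilbert_space" and S :: "'i set"
  assumes orth: "orthonormal e S"
begin

lemma orthonormal_finite_sum_le:
  assumes "finite F"
  shows "(\<Sum>i\<in>F. (cmod (if i \<in> S then cinner x (e i) else 0))\<^sup>2) \<le> (norm x)\<^sup>2"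
proof -
  have "(\<Sum>i\<in>F. (cmod (if i \<in> S then cinner x (e i) else 0))\<^sup>2)
      = (\<Sum>i\<in>F \<inter> S. (cmod (cinner x (e i)))\<^sup>2)"
    using assms by (intro sum.mono_neutral_cong_right) auto
  also have "\<dots> \<le> (norm x)\<^sup>2"
    using orth assms by (intro bessel) (auto simp: orthonormal_def)
  finally show ?thesis .
qed

lemma coord_coefficients:
  "coord (coefficients e S x) i = (if i \<in> S then cinner x (e i) else 0)"
proof -
  have "(\<lambda>i. (cmod (if i \<in> S then cinner x (e i) else 0))\<^sup>2) summable_on UNIV"
    by (rule square_summableI) (rule orthonormal_finite_sum_le)
  then show ?thesis
    unfolding coefficients_def by (subst Abs_ell2_inverse) auto
qed

lemma norm_coefficients_le: "norm (coefficients e S x) \<le> norm x"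
proof (rule ell2_norm_le)
  fix F :: "'i set" assume "finite F"
  then show "L2_set (\<lambda>i. cmod (coord (coefficients e S x) i)) F \<le> norm x"
    unfolding L2_set_def coord_coefficients
    by (intro real_le_lsqrt orthonormal_finite_sum_le sum_nonneg) auto
qed

lemma clinear_coefficients: "clinear (coefficients e S)"
  by (rule clinearI; rule ell2_eqI)
    (simp_all add: coord_coefficients plus_ell2.rep_eq scaleC_ell2.rep_eq cinner_add_left
      cinner_scaleC_left)

lemma coefficients_basis:
  assumes "i \<in> S"
  shows "coefficients e S (e i) = \<xi> i"
  using orth assms
  by (intro ell2_eqI) (auto simp: coord_coefficients ket.rep_eq orthonormal_def)

lemma bounded_linear_coefficients: "bounded_linear (coefficients e S)"
  by (rule bounded_clinear_imp_bounded_linear)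
    (auto simp: bounded_clinear_def clinear_coefficients intro!: exI[of _ 1] norm_coefficients_le)

text \<open>The argument runs over \<open>y\<close> with \<open>x\<close> fixed and unrestricted, because
  the set of good \<open>y\<close> is then visibly a closed subspace; the set of vectors whose norm is
  preserved is not.\<close>

lemma coefficients_cinner:
  assumes "y \<in> closure (cspan (e ` S))"
  shows "cinner (coefficients e S x) (coefficients e S y) = cinner x y"
proof -
  let ?M = "{y. cinner (coefficients e S x) (coefficients e S y) = cinner x y}"
  have "e ` S \<subseteq> ?M"
    by (auto simp: coefficients_basis coord_eq_cinner_ket coord_coefficients)
  moreover have "complex_vector.subspace ?M"
    unfolding complex_vector.subspace_def
    by (auto simp: cinner_add_right cinner_scaleC_right clinear_0[OF clinear_coefficients]
        clinear_add[OF clinear_coefficients] clinear_scaleC[OF clinear_coefficients])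
  moreover have "closed ?M"
    by (intro closed_Collect_eq continuous_intros
        linear_continuous_on[OF bounded_linear_coefficients])
  ultimately show ?thesis
    using closure_cspan_minimal assms by blast
qed

lemma norm_coefficients:
  assumes "y \<in> closure (cspan (e ` S))"
  shows "norm (coefficients e S y) = norm y"
proof -
  have "(norm (coefficients e S y))\<^sup>2 = (norm y)\<^sup>2"
    using coefficients_cinner[OF assms, of y] unfolding cinner_self of_real_eq_iff .
  then show ?thesis by simp
qed

text \<open>This is the Riesz--Fischer theorem, without summing a series in the Hilbert space: the image of
  the closed span is complete, since the coefficient map is isometric there, and it contains the basis
  vectors of \<open>\<ell>\<^sub>2(S)\<close>.\<close>

lemma coefficients_closed_span: "coefficients e S ` closure (cspan (e ` S)) = ell2_on S"
proof
  show "coefficients e S ` closure (cspan (e ` S)) \<subseteq> ell2_on S"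
    by (auto simp: ell2_on_def coord_coefficients)
  let ?N = "closure (cspan (e ` S))"
  have N: "complex_vector.subspace ?N"
    by (intro closure_complex_subspace complex_vector.subspace_span)
  have "complete (coefficients e S ` ?N)"
  proof (rule complete_isometric_image[where e = 1])
    show "\<forall>x\<in>?N. norm (coefficients e S x) \<ge> 1 * norm x"
      by (simp add: norm_coefficients)
  qed (use N in \<open>auto intro: subspace_imp_real_subspace bounded_linear_coefficients
      simp: complete_eq_closed\<close>)
  moreover have "\<xi> ` S \<subseteq> coefficients e S ` ?N"
  proof
    fix v assume "v \<in> \<xi> ` S"
    then obtain i where i: "i \<in> S" "v = \<xi> i" by auto
    then have "e i \<in> ?N"
      by (intro subsetD[OF closure_subset] complex_vector.span_base) simp
    then show "v \<in> coefficients e S ` ?N"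
      using i coefficients_basis[OF i(1)] by (metis image_eqI)
  qed
  moreover have "complex_vector.subspace (coefficients e S ` ?N)"
    by (intro clinear_subspace_image clinear_coefficients N)
  ultimately have "closure (cspan (\<xi> ` S)) \<subseteq> coefficients e S ` ?N"
    by (intro closure_cspan_minimal) (auto simp: complete_eq_closed)
  then show "ell2_on S \<subseteq> coefficients e S ` ?N"
    using ell2_on_subset_closure_span_ket by blast
qed

text \<open>Riesz--Fischer provides a \<open>y\<close> in the closed span with the same coefficients as \<open>x\<close>.\<close>

lemma orthonormal_projection:
  obtains y where "y \<in> closure (cspan (e ` S))" "\<And>i. i \<in> S \<Longrightarrow> cinner (x - y) (e i) = 0"
proof -
  have "coefficients e S x \<in> ell2_on S"
    by (simp add: ell2_on_def coord_coefficients)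
  then obtain y where y: "y \<in> closure (cspan (e ` S))" "coefficients e S x = coefficients e S y"
    unfolding coefficients_closed_span[symmetric] by blast
  have "cinner (x - y) (e i) = 0" if "i \<in> S" for i
    using arg_cong[OF y(2), of "\<lambda>f. coord f i"] that by (simp add: coord_coefficients cinner_diff_left)
  then show ?thesis using y(1) that by blast
qed

lemma isometry_coefficients:
  assumes total: "\<And>x. (\<And>i. i \<in> S \<Longrightarrow> cinner x (e i) = 0) \<Longrightarrow> x = 0"
  shows "isometry (coefficients e S)" "range (coefficients e S) = ell2_on S"
proof -
  have "closure (cspan (e ` S)) = UNIV"
  proof (intro set_eqI iffI UNIV_I)
    fix x :: 'a
    obtain y where y: "y \<in> closure (cspan (e ` S))" "\<And>i. i \<in> S \<Longrightarrow> cinner (x - y) (e i) = 0"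
      using orthonormal_projection by blast
    then have "x - y = 0" using total by blast
    then show "x \<in> closure (cspan (e ` S))" using y(1) by simp
  qed
  then show "isometry (coefficients e S)" "range (coefficients e S) = ell2_on S"
    using norm_coefficients clinear_coefficients coefficients_closed_span
    by (auto simp: isometry_def)
qed

end


section \<open>Projections onto closed subspaces\<close>

lemma maximal_orthonormal_set:
  fixes M :: "'a::chilbert_space set"
  assumes M: "complex_vector.subspace M"
  obtains B where "B \<subseteq> M" "orthonormal id B"
    "\<forall>x\<in>M. (\<forall>b\<in>B. cinner x b = 0) \<longrightarrow> x = 0"
proof -
  let ?A = "{B. B \<subseteq> M \<and> orthonormal id B}"
  have "\<exists>B\<in>?A. \<forall>X\<in>?A. B \<subseteq> X \<longrightarrow> X = B"
  proof (rule Zorn_Lemma)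
    show "\<forall>C\<in>chains ?A. \<Union>C \<in> ?A"
    proof
      fix C assume C: "C \<in> chains ?A"
      have "orthonormal id (\<Union>C)"
        unfolding orthonormal_def
      proof (intro ballI)
        fix x y assume "x \<in> \<Union>C" "y \<in> \<Union>C"
        then obtain X Y where XY: "X \<in> C" "x \<in> X" "Y \<in> C" "y \<in> Y" by blast
        then have "X \<subseteq> Y \<or> Y \<subseteq> X" using C chainsD by blast
        then obtain Z where "Z \<in> C" "x \<in> Z" "y \<in> Z" using XY by blast
        moreover have "orthonormal id Z" using C \<open>Z \<in> C\<close> chainsD2 by blast
        ultimately show "cinner (id x) (id y) = (if x = y then 1 else 0)"
          by (auto simp: orthonormal_def)
      qed
      then show "\<Union>C \<in> ?A" using chainsD2[OF C] by blast
    qed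
  qed
  then obtain B where B_max: "B \<in> ?A" "\<forall>X\<in>?A. B \<subseteq> X \<longrightarrow> X = B" by (rule bexE)
  then have B: "B \<subseteq> M" "orthonormal id B" by simp_all
  have max: "X = B" if "X \<subseteq> M" "orthonormal id X" "B \<subseteq> X" for X
    using B_max(2) that by simp
  have "x = 0" if x: "x \<in> M" "\<And>b. b \<in> B \<Longrightarrow> cinner x b = 0" for x
  proof (rule ccontr)
    assume "x \<noteq> 0"
    define u where "u = complex_of_real (1 / norm x) *\<^sub>C x"
    have uu: "cinner u u = 1"
      unfolding u_def using \<open>x \<noteq> 0\<close> by (rule cinner_normalized)
    have ub: "cinner u b = 0" "cinner b u = 0" if "b \<in> B" for b
      using x(2)[OF that] cinner_eq_zero_commute[of b u] by (simp_all add: u_def cinner_scaleC_left)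
    have "orthonormal id (insert u B)"
      using B(2) uu ub by (auto simp: orthonormal_def)
    moreover have "insert u B \<subseteq> M"
      using B(1) x(1) complex_vector.subspace_scale[OF M] by (simp add: u_def)
    ultimately have "u \<in> B" using max[of "insert u B"] by blast
    then show False using ub uu by force
  qed
  then show ?thesis using that B by blast
qed

text \<open>A maximal orthonormal set in \<open>M\<close> has closed span \<open>M\<close>, so that the projection onto
  the closed span of an orthonormal family is available.\<close>

lemma projection_exists:
  assumes M: "complex_vector.subspace M" "closed M"
  obtains y where "is_projection_onto M x y"
proof -
  obtain B where B: "B \<subseteq> M" "orthonormal id B"
    and max: "\<forall>x\<in>M. (\<forall>b\<in>B. cinner x b = 0) \<longrightarrow> x = 0"
    by (rule maximal_orthonormal_set[OF M(1)])
  have sub: "closure (cspan (id ` B)) \<subseteq> M"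
    using B(1) M by (intro closure_cspan_minimal) auto
  have M_sub: "M \<subseteq> closure (cspan (id ` B))"
  proof
    fix m assume m: "m \<in> M"
    obtain z where z: "z \<in> closure (cspan (id ` B))" "\<And>b. b \<in> B \<Longrightarrow> cinner (m - z) (id b) = 0"
      using orthonormal_projection[OF B(2)] by blast
    have "m - z \<in> M"
      using m z(1) sub complex_vector.subspace_diff[OF M(1)] by blast
    then have "m - z = 0" using z(2) max by (metis id_apply)
    then show "m \<in> closure (cspan (id ` B))" using z(1) by simp
  qed
  obtain y where y: "y \<in> closure (cspan (id ` B))" "\<And>b. b \<in> B \<Longrightarrow> cinner (x - y) (id b) = 0"
    using orthonormal_projection[OF B(2)] by blast
  have "closure (cspan (id ` B)) \<subseteq> {m. cinner (x - y) m = 0}"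
  proof (rule closure_cspan_minimal)
    show "id ` B \<subseteq> {m. cinner (x - y) m = 0}" using y(2) by auto
    show "complex_vector.subspace {m. cinner (x - y) m = 0}"
      by (auto simp: complex_vector.subspace_def cinner_add_right cinner_scaleC_right)
    show "closed {m. cinner (x - y) m = 0}"
      by (intro closed_Collect_eq continuous_intros)
  qed
  then have "is_projection_onto M x y"
    using y(1) sub M_sub unfolding is_projection_onto_def by blast
  then show ?thesis using that by blast
qed


section \<open>The Wold decomposition of an isometry without unitary part\<close>

lemma isometry_range:
  fixes V :: "'a::chilbert_space \<Rightarrow> 'b::chilbert_space"
  assumes "isometry V"
  shows "complex_vector.subspace (range V)" "closed (range V)"
proof -
  have lin: "clinear V" using assms by (simp add: isometry_def)
  show "complex_vector.subspace (range V)"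
    by (intro clinear_subspace_image lin complex_vector.subspace_UNIV)
  have "complete (range V)"
    using assms isometry_imp_bounded_linear[OF assms]
    by (intro complete_isometric_image[where e = 1]) (auto simp: isometry_def complete_UNIV)
  then show "closed (range V)" by (simp add: complete_eq_closed)
qed

text \<open>Let \<open>L\<close> be the orthogonal complement of the range of \<open>V\<close> and
  \<open>I\<close> a maximal orthonormal subset of \<open>L\<close>. The vectors \<open>V\<^sup>k b\<close> with \<open>b \<in> I\<close> are orthonormal, and a
  vector orthogonal to all of them is orthogonal to \<open>L\<close>, hence of the form \<open>V y\<close>, where \<open>y\<close> is again
  orthogonal to all of them. So such a vector lies in the range of every power of \<open>V\<close>, and
  is zero when \<open>V\<close> has no unitary part. The coefficient map of this family then turns \<open>V\<close> into a
  direct sum of unilateral shifts, one for each element of \<open>I\<close>.\<close>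

lemma isometry_is_shift:
  fixes V :: "'k::chilbert_space \<Rightarrow> 'k"
  assumes V: "isometry V"
    and pure: "\<And>x. (\<And>k. x \<in> range (V ^^ k)) \<Longrightarrow> x = 0"
  shows "is_shift V"
proof -
  define L where "L = {x. \<forall>y. cinner x (V y) = 0}"
  have "complex_vector.subspace L"
    by (auto simp: L_def complex_vector.subspace_def cinner_add_left cinner_scaleC_left)
  then obtain I where I: "I \<subseteq> L" "orthonormal id I"
    and max: "\<forall>x\<in>L. (\<forall>b\<in>I. cinner x b = 0) \<longrightarrow> x = 0"
    using maximal_orthonormal_set[of L] by blast
  define e where "e = (\<lambda>(b, k). (V ^^ k) b)"
  have e_0: "e (b, 0) = b" and e_Suc: "e (b, Suc m) = V (e (b, m))" for b m
    by (simp_all add: e_def)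
  have e_zero: "cinner (e (b, j)) (V ((V ^^ (k + j)) x)) = 0" if "b \<in> I" for b j k x
  proof -
    have "cinner ((V ^^ j) b) ((V ^^ j) ((V ^^ Suc k) x)) = cinner b (V ((V ^^ k) x))"
      by (simp add: isometry_cinner[OF isometry_funpow[OF V]])
    also have "\<dots> = 0" using that I(1) by (auto simp: L_def)
    finally show ?thesis
      unfolding e_def by (simp add: funpow_add add.commute[of k j] funpow_swap1)
  qed
  have e_lt: "cinner (e (b, j)) (e (c, k)) = 0" if "b \<in> I" "j < k" for b c j k
  proof -
    obtain i where "k = Suc (i + j)" using \<open>j < k\<close> less_iff_Suc_add by (auto simp: add.commute)
    then show ?thesis using e_zero[OF that(1), of j i c] by (simp add: e_def)
  qed
  have orth: "orthonormal e (I \<times> UNIV)"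
    unfolding orthonormal_def
  proof clarify
    fix b c :: 'k and j k :: nat
    assume bc: "b \<in> I" "c \<in> I"
    consider "j < k" | "k < j" | "j = k" by linarith
    then show "cinner (e (b, j)) (e (c, k)) = (if (b, j) = (c, k) then 1 else 0)"
    proof cases
      case 3
      then show ?thesis
        using bc I(2) by (simp add: e_def isometry_cinner[OF isometry_funpow[OF V]] orthonormal_def)
    next
      case 1
      then show ?thesis using e_lt bc by simp
    next
      case 2
      then have "cinner (e (c, k)) (e (b, j)) = 0" using e_lt bc by simp
      then show ?thesis using 2 cinner_eq_zero_commute[of "e (c, k)"] by simp
    qed
  qed
  have total: "x = 0" if "\<And>i. i \<in> I \<times> UNIV \<Longrightarrow> cinner x (e i) = 0" for x
  proof (rule pure)
    fix k
    have "\<And>i. i \<in> I \<times> UNIV \<Longrightarrow> cinner x (e i) = 0" by fact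
    then show "x \<in> range (V ^^ k)"
    proof (induction k arbitrary: x)
      case (Suc k)
      obtain p where p: "is_projection_onto (range V) x p"
        using projection_exists isometry_range[OF V] by blast
      then obtain y where y: "p = V y" by (auto simp: is_projection_onto_def)
      have "x - p \<in> L"
        using p by (auto simp: is_projection_onto_def L_def)
      moreover have "cinner (x - p) b = 0" if "b \<in> I" for b
      proof -
        have "cinner b (V y) = 0" using that I(1) by (auto simp: L_def)
        moreover have "cinner x b = 0" using Suc.prems[of "(b, 0)"] that by (simp add: e_0)
        ultimately show ?thesis
          using cinner_eq_zero_commute[of b "V y"] by (simp add: cinner_diff_left y)
      qed
      ultimately have "x - p = 0" using max by blast
      then have x: "x = V y" using y by simp
      have "cinner y (e i) = 0" if "i \<in> I \<times> UNIV" for i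
      proof -
        obtain b j where i: "i = (b, j)" "b \<in> I" using \<open>i \<in> I \<times> UNIV\<close> by auto
        have "cinner (V y) (V (e i)) = 0"
          using Suc.prems[of "(b, Suc j)"] i by (simp add: e_Suc x)
        then show ?thesis by (simp add: isometry_cinner[OF V])
      qed
      then have "y \<in> range (V ^^ k)" by (rule Suc.IH)
      then show ?case using x by auto
    qed simp
  qed
  have "coefficients e (I \<times> UNIV) (V x) = shift_copies (coefficients e (I \<times> UNIV) x)" for x
  proof (rule ell2_eqI)
    fix i :: "'k \<times> nat"
    obtain b k where i: "i = (b, k)" by fastforce
    show "coord (coefficients e (I \<times> UNIV) (V x)) i
        = coord (shift_copies (coefficients e (I \<times> UNIV) x)) i"
    proof (cases k)
      case 0
      have "cinner (V x) b = 0" if "b \<in> I"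
        using that I(1) cinner_eq_zero_commute[of b "V x"] by (auto simp: L_def)
      then show ?thesis
        by (simp add: i 0 coord_coefficients[OF orth] shift_copies.rep_eq e_0)
    next
      case (Suc m)
      then show ?thesis
        by (simp add: i coord_coefficients[OF orth] shift_copies.rep_eq e_Suc isometry_cinner[OF V])
    qed
  qed
  with isometry_coefficients[OF orth total] show ?thesis
    unfolding is_shift_def by blast
qed


section \<open>Dilations of operators whose adjoint powers tend to zero\<close>

text \<open>The last hypothesis says that the functionals \<open>h \<mapsto> \<langle>T\<^sup>k h, b\<rangle>\<close> tend to zero in norm, that is, that
  the powers of the adjoint of \<open>T\<close> tend to zero at every \<open>b\<close> in a total set. Stating it with functionals
  avoids the adjoint.

  The dilation inherits the estimate: \<open>\<bar>\<langle>V\<^sup>k z, J b\<rangle>\<bar>\<close> is at most \<open>\<epsilon>\<^sub>k \<parallel>z\<parallel>\<close> for all \<open>z\<close>. A vector \<open>x\<close> in the range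
  of all powers of \<open>V\<close> is \<open>V\<^sup>k z\<^sub>k\<close> with \<open>\<parallel>z\<^sub>k\<parallel> = \<parallel>x\<parallel>\<close>, so it is orthogonal to the range of \<open>J\<close>. The set of these
  vectors is invariant under undoing \<open>V\<close>; hence \<open>x\<close> is orthogonal to every \<open>V\<^sup>j J h\<close>, and by minimality
  \<open>x = 0\<close>.\<close>

lemma dilation_is_shift:
  fixes T :: "'h::chilbert_space \<Rightarrow> 'h" and J :: "'h \<Rightarrow> 'k::chilbert_space"
  assumes dil: "minimal_isometric_dilation T J V" and T: "clinear T"
    and total: "closure (cspan B) = UNIV"
    and decay: "\<And>b. b \<in> B \<Longrightarrow>
      \<exists>\<epsilon>. \<epsilon> \<longlonglongrightarrow> 0 \<and> (\<forall>k h. cmod (cinner ((T ^^ k) h) b) \<le> \<epsilon> k * norm h)"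
  shows "is_shift V"
proof -
  let ?D = "cspan (\<Union>k. (V ^^ k) ` range J)"
  have J: "isometry J" and V: "isometry V"
    and proj: "\<And>k x. is_projection_onto (range J) ((V ^^ k) (J x)) (J ((T ^^ k) x))"
    and dense: "closure ?D = UNIV"
    using dil by (auto simp: minimal_isometric_dilation_def)
  have Vk: "isometry (V ^^ k)" for k using V by (rule isometry_funpow)
  have V_lin: "clinear (V ^^ k)" for k using Vk by (simp add: isometry_def)
  have T_lin: "clinear (T ^^ k)" for k using T by (rule clinear_funpow)

  \<comment> \<open>The vector \<open>h\<close> plays the role of the projection of \<open>z\<close> to the original space. One \<open>h\<close> serves
    all \<open>k\<close>: this is the co-invariance of that space under \<open>V\<close>.\<close>
  have compress: "\<exists>h. \<forall>k g. cinner ((V ^^ k) z) (J g) = cinner ((T ^^ k) h) g" if "z \<in> ?D" for z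
  proof -
    let ?P = "\<lambda>z h. \<forall>k g. cinner ((V ^^ k) z) (J g) = cinner ((T ^^ k) h) g"
    have "?D \<subseteq> {z. \<exists>h. ?P z h}"
    proof (rule complex_vector.span_minimal)
      have "?P ((V ^^ j) (J x)) ((T ^^ j) x)" for j x
      proof (intro allI)
        fix k g
        have "cinner ((V ^^ (k + j)) (J x)) (J g) = cinner (J ((T ^^ (k + j)) x)) (J g)"
          using proj[of "k + j" x] by (simp add: is_projection_onto_def cinner_diff_left)
        then show "cinner ((V ^^ k) ((V ^^ j) (J x))) (J g) = cinner ((T ^^ k) ((T ^^ j) x)) g"
          by (simp add: funpow_add isometry_cinner[OF J])
      qed
      then show "(\<Union>k. (V ^^ k) ` range J) \<subseteq> {z. \<exists>h. ?P z h}" by blast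
      have P_0: "?P 0 0"
        by (simp add: clinear_0[OF V_lin] clinear_0[OF T_lin])
      have P_add: "?P (z + z') (h + h')" if "?P z h" "?P z' h'" for z z' h h'
        using that by (simp add: clinear_add[OF V_lin] clinear_add[OF T_lin] cinner_add_left)
      have P_scale: "?P (c *\<^sub>C z) (c *\<^sub>C h)" if "?P z h" for c z h
        using that by (simp add: clinear_scaleC[OF V_lin] clinear_scaleC[OF T_lin] cinner_scaleC_left)
      show "complex_vector.subspace {z. \<exists>h. ?P z h}"
      proof (rule complex_vector.subspaceI; (elim CollectE exE)?; rule CollectI)
        show "\<exists>h. ?P 0 h" using P_0 by (rule exI)
        show "\<exists>h. ?P (z + z') h" if "?P z h" "?P z' h'" for z z' h h'
          using P_add[OF that] by (rule exI)
        show "\<exists>h. ?P (c *\<^sub>C z) h" if "?P z h" for c z h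
          using P_scale[OF that] by (rule exI)
      qed
    qed
    then show ?thesis using that by blast
  qed

  have bound: "cmod (cinner ((V ^^ k) z) (J b)) \<le> \<epsilon> * norm z"
    if b: "\<And>h. cmod (cinner ((T ^^ k) h) b) \<le> \<epsilon> * norm h" and \<epsilon>: "\<epsilon> \<ge> 0" for b \<epsilon> k z
  proof -
    have "?D \<subseteq> {z. cmod (cinner ((V ^^ k) z) (J b)) \<le> \<epsilon> * norm z}"
    proof clarify
      fix z assume "z \<in> ?D"
      then obtain h where h: "\<And>k g. cinner ((V ^^ k) z) (J g) = cinner ((T ^^ k) h) g"
        using compress by blast
      have "(norm h)\<^sup>2 = cmod (cinner h h)"
        by (simp add: cinner_self norm_power)
      also have "\<dots> = cmod (cinner z (J h))"
        using h[of 0 h] by simp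
      also have "\<dots> \<le> norm z * norm h"
        using cauchy_schwarz[of z "J h"] J by (simp add: isometry_def)
      finally have "norm h \<le> norm z"
        by (cases "h = 0") (simp_all add: power2_eq_square)
      then have "\<epsilon> * norm h \<le> \<epsilon> * norm z" using \<epsilon> by (rule mult_left_mono)
      then show "cmod (cinner ((V ^^ k) z) (J b)) \<le> \<epsilon> * norm z"
        using b[of h] unfolding h by linarith
    qed
    moreover have "closed {z. cmod (cinner ((V ^^ k) z) (J b)) \<le> \<epsilon> * norm z}"
      by (intro closed_Collect_le continuous_intros
          linear_continuous_on[OF isometry_imp_bounded_linear[OF Vk]])
    ultimately have "closure ?D \<subseteq> {z. cmod (cinner ((V ^^ k) z) (J b)) \<le> \<epsilon> * norm z}"
      by (rule closure_minimal)
    then show ?thesis using dense by blast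
  qed

  show ?thesis
  proof (rule isometry_is_shift[OF V])
    fix x assume x: "\<And>k. x \<in> range (V ^^ k)"
    have orth: "cinner y (J g) = 0" if y: "\<And>k. y \<in> range (V ^^ k)" for y g
    proof -
      have "B \<subseteq> {g. cinner y (J g) = 0}"
      proof clarify
        fix b assume "b \<in> B"
        then obtain \<epsilon> where \<epsilon>: "\<epsilon> \<longlonglongrightarrow> 0" "\<And>k h. cmod (cinner ((T ^^ k) h) b) \<le> \<epsilon> k * norm h"
          using decay by blast
        have "cmod (cinner y (J b)) \<le> \<bar>\<epsilon> k\<bar> * norm y" for k
        proof -
          obtain z where z: "y = (V ^^ k) z" using y by blast
          have "cmod (cinner ((V ^^ k) z) (J b)) \<le> \<bar>\<epsilon> k\<bar> * norm z"
          proof (rule bound)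
            show "cmod (cinner ((T ^^ k) h) b) \<le> \<bar>\<epsilon> k\<bar> * norm h" for h
              by (rule order_trans[OF \<epsilon>(2)]) (intro mult_right_mono, auto)
          qed simp
          then show ?thesis using Vk[of k] by (simp add: z isometry_def)
        qed
        moreover have "(\<lambda>k. \<bar>\<epsilon> k\<bar> * norm y) \<longlonglongrightarrow> 0"
          using \<epsilon>(1) by (intro tendsto_mult_left_zero tendsto_rabs_zero)
        ultimately have "cmod (cinner y (J b)) \<le> 0"
          by (intro LIMSEQ_le_const) auto
        then show "cinner y (J b) = 0" by simp
      qed
      moreover have "complex_vector.subspace {g. cinner y (J g) = 0}"
      proof -
        have "clinear J" using J by (simp add: isometry_def)
        then show ?thesis
          by (simp add: complex_vector.subspace_def clinear_0 clinear_add clinear_scaleC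
              cinner_add_right cinner_scaleC_right)
      qed
      moreover have "closed {g. cinner y (J g) = 0}"
        by (intro closed_Collect_eq continuous_intros
            linear_continuous_on[OF isometry_imp_bounded_linear[OF J]])
      ultimately show ?thesis
        using closure_cspan_minimal total by blast
    qed
    have "(\<Union>k. (V ^^ k) ` range J) \<subseteq> {z. cinner x z = 0}"
    proof clarify
      fix k g
      obtain y where y: "x = (V ^^ k) y" using x by blast
      have "y \<in> range (V ^^ j)" for j
      proof -
        obtain z where "x = (V ^^ (k + j)) z" using x by blast
        then have "(V ^^ k) (y - (V ^^ j) z) = 0"
          by (simp add: y funpow_add clinear_diff[OF V_lin])
        then have "norm (y - (V ^^ j) z) = 0"
          using Vk[of k] unfolding isometry_def by (metis norm_zero)
        then show ?thesis by simp
      qed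
      then show "cinner x ((V ^^ k) (J g)) = 0"
        using orth by (simp add: y isometry_cinner[OF Vk])
    qed
    moreover have "complex_vector.subspace {z. cinner x z = 0}"
      by (simp add: complex_vector.subspace_def cinner_add_right cinner_scaleC_right)
    moreover have "closed {z. cinner x z = 0}"
      by (intro closed_Collect_eq continuous_intros)
    ultimately have "x \<in> {z. cinner x z = 0}"
      using closure_cspan_minimal dense by blast
    then show "x = 0" by simp
  qed
qed


section \<open>Left multipliers on the free semigroup\<close>

lift_definition right_creation :: "'n \<Rightarrow> 'n list ell2 \<Rightarrow> 'n list ell2" is
  "\<lambda>i f w. if w \<noteq> [] \<and> last w = i then f (butlast w) else 0"
proof -
  fix i and f :: "'n list \<Rightarrow> complex" assume "(\<lambda>i. (cmod (f i))\<^sup>2) summable_on UNIV"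
  then show "(\<lambda>w. (cmod (if w \<noteq> [] \<and> last w = i then f (butlast w) else 0))\<^sup>2) summable_on UNIV"
  proof (rule square_summable_push(1)[where h = "\<lambda>v. v @ [i]"])
    fix w assume "w \<notin> range (\<lambda>v. v @ [i])"
    then have "\<not> (w \<noteq> [] \<and> last w = i)" by (metis append_butlast_last_id rangeI)
    then show "(if w \<noteq> [] \<and> last w = i then f (butlast w) else 0) = 0" by auto
  qed (auto simp: inj_def)
qed

lemma right_creation_ket: "right_creation i (\<xi> v) = \<xi> (v @ [i])"
  by transfer (auto simp: fun_eq_iff)

lemma right_creation_add: "right_creation i (x + y) = right_creation i x + right_creation i y"
  by transfer auto

lemma right_creation_scaleC: "right_creation i (c *\<^sub>C x) = c *\<^sub>C right_creation i x"
  by transfer auto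

text \<open>Left and right multiplication in the free semigroup commute by associativity.\<close>

lemma left_right_creation_commute:
  "left_creation i (right_creation j x) = right_creation j (left_creation i x)"
  by transfer (auto simp: fun_eq_iff split: list.split)

definition right_creation_commutant :: "('n list ell2 \<Rightarrow> 'n list ell2) set" where
  "right_creation_commutant =
     {T. bounded_clinear T \<and> (\<forall>j x. T (right_creation j x) = right_creation j (T x))}"

lemma unital_subalgebra_right_creation_commutant: "unital_subalgebra right_creation_commutant"
proof -
  note bl = bounded_clinear_imp_bounded_linear
  have lin: "clinear S" if "bounded_clinear S" for S :: "'n list ell2 \<Rightarrow> 'n list ell2"
    using that by (simp add: bounded_clinear_def)
  have "bounded_clinear (id :: 'n list ell2 \<Rightarrow> 'n list ell2)"
    by (rule bounded_clinearI) (auto intro: clinearI simp: id_def bounded_linear_ident)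
  moreover have "bounded_clinear (\<lambda>x. S x + T x)" "bounded_clinear (S \<circ> T)"
    "bounded_clinear (\<lambda>x. c *\<^sub>C S x)"
    if "bounded_clinear S" "bounded_clinear T" for S T :: "'n list ell2 \<Rightarrow> 'n list ell2" and c
  proof -
    note ST = that[THEN lin] that[THEN bl]
    show "bounded_clinear (\<lambda>x. S x + T x)"
      by (intro bounded_clinearI clinearI bounded_linear_add ST)
        (simp_all add: clinear_add[OF ST(1)] clinear_add[OF ST(2)] clinear_scaleC[OF ST(1)]
          clinear_scaleC[OF ST(2)] scaleC_add_right)
    show "bounded_clinear (S \<circ> T)"
      unfolding o_def
      by (intro bounded_clinearI clinearI bounded_linear_compose[OF ST(3) ST(4)])
        (simp_all add: clinear_add[OF ST(1)] clinear_add[OF ST(2)] clinear_scaleC[OF ST(1)]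
          clinear_scaleC[OF ST(2)])
    show "bounded_clinear (\<lambda>x. c *\<^sub>C S x)"
      by (intro bounded_clinearI clinearI bounded_linear_compose[OF bounded_linear_scaleC ST(3)])
        (simp_all add: clinear_add[OF ST(1)] clinear_scaleC[OF ST(1)] scaleC_add_right
          scaleC_scaleC mult.commute)
  qed
  ultimately show ?thesis
    by (auto simp: unital_subalgebra_def right_creation_commutant_def right_creation_add
        right_creation_scaleC)
qed

text \<open>Matrix entries are by definition continuous in the weak operator topology.\<close>

lemma continuous_map_wot_entry:
  "continuous_map weak_operator_topology euclidean (\<lambda>T. cinner (T x) y)"
proof -
  have "continuous_map euclidean euclidean (\<lambda>F :: 'a \<times> 'a \<Rightarrow> complex. F (x, y))"
    by (simp add: continuous_on_product_coordinates)
  from continuous_map_pullback[OF this, of "{T. bounded_clinear T}" "\<lambda>T (x, y). cinner (T x) y"]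
  show ?thesis by (simp add: weak_operator_topology_def o_def)
qed

lemma topspace_wot: "topspace weak_operator_topology = {T. bounded_clinear T}"
  by (simp add: weak_operator_topology_def topspace_pullback_topology)

text \<open>Comparing coordinates expresses the commutation relations as equalities between matrix
  entries of \<open>T\<close>, because each coordinate of \<open>right_creation j f\<close> is zero or a coordinate of \<open>f\<close>.\<close>

lemma closedin_right_creation_commutant:
  "closedin weak_operator_topology (right_creation_commutant :: ('n list ell2 \<Rightarrow> _) set)"
proof -
  let ?W = "weak_operator_topology :: ('n list ell2 \<Rightarrow> 'n list ell2) topology"
  let ?C = "\<lambda>j x w. {T \<in> topspace ?W. coord (T (right_creation j x)) w = coord (right_creation j (T x)) w}"
  have coord_cont: "continuous_map ?W euclidean (\<lambda>T. coord (T x) w)" for x w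
    using continuous_map_wot_entry[of x "\<xi> w"] by (simp add: coord_eq_cinner_ket)
  have "continuous_map ?W euclidean (\<lambda>T. coord (right_creation j (T x)) w)" for j x w
    unfolding right_creation.rep_eq
    by (cases "w \<noteq> [] \<and> last w = j") (simp_all add: coord_cont)
  then have "closedin ?W (?C j x w)" for j x w
    by (intro closedin_continuous_maps_eq[of euclidean] coord_cont) auto
  then have "closedin ?W (\<Inter>(j, x, w)\<in>UNIV. ?C j x w)"
    by (intro closedin_INT) auto
  moreover have "(\<Inter>(j, x, w)\<in>UNIV. ?C j x w) = right_creation_commutant"
    by (auto simp: topspace_wot right_creation_commutant_def intro: ell2_eqI)
  ultimately show ?thesis by simp
qed

lemma nc_toeplitz_subset_commutant: "nc_toeplitz \<subseteq> right_creation_commutant"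
  unfolding nc_toeplitz_def
proof (rule hull_minimal)
  show "range left_creation \<subseteq> (right_creation_commutant :: ('n list ell2 \<Rightarrow> 'n list ell2) set)"
  proof -
    have "bounded_clinear (left_creation i :: 'n list ell2 \<Rightarrow> 'n list ell2)" for i
      using isometry_left_creation[of i] isometry_imp_bounded_linear
      by (intro bounded_clinearI) (auto simp: isometry_def)
    then show ?thesis
      by (auto simp: right_creation_commutant_def left_right_creation_commute)
  qed
qed (simp add: unital_subalgebra_right_creation_commutant closedin_right_creation_commutant)

text \<open>An operator that commutes with right creation is determined by its symbol
  \<open>a = T \<xi>\<^bsub>[]\<^esub>\<close>, and acts as convolution by \<open>a\<close> from the left. On basis vectors this follows by building
  words from the right, and both sides are continuous and linear in \<open>y\<close>. The sum is finite since a word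
  has only finitely many factorizations.\<close>

lemma coord_left_multiplier:
  assumes "T \<in> right_creation_commutant"
  shows "coord (T y) w = (\<Sum>i\<le>length w. coord (T (\<xi> [])) (take i w) * coord y (drop i w))"
proof -
  let ?a = "coord (T (\<xi> []))"
  let ?M = "\<lambda>w. {y. coord (T y) w = (\<Sum>i\<le>length w. ?a (take i w) * coord y (drop i w))}"
  have T: "bounded_clinear T" "\<And>j x. T (right_creation j x) = right_creation j (T x)"
    using assms by (auto simp: right_creation_commutant_def)
  then have lin: "clinear T" by (simp add: bounded_clinear_def)
  have "\<xi> v \<in> ?M w" for v w
  proof (induction v arbitrary: w rule: rev_induct)
    case Nil
    have "(\<Sum>i\<le>length w. ?a (take i w) * coord (\<xi> []) (drop i w))
        = (\<Sum>i\<in>{length w}. ?a (take i w) * coord (\<xi> []) (drop i w))"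
      by (intro sum.mono_neutral_right) (auto simp: ket.rep_eq)
    then show ?case by (simp add: ket.rep_eq)
  next
    case (snoc j v)
    have *: "coord (T (\<xi> (v @ [j]))) w = coord (right_creation j (T (\<xi> v))) w"
      using T(2)[of j "\<xi> v"] by (simp add: right_creation_ket)
    show ?case
    proof (cases w rule: rev_cases)
      case Nil
      then show ?thesis using * by (simp add: right_creation.rep_eq ket.rep_eq)
    next
      case (snoc u i)
      have "(\<Sum>k\<le>length w. ?a (take k w) * coord (\<xi> (v @ [j])) (drop k w))
          = (\<Sum>k\<le>length u. ?a (take k w) * coord (\<xi> (v @ [j])) (drop k w))"
        using snoc by (intro sum.mono_neutral_right) (auto simp: ket.rep_eq)
      also have "\<dots> = (\<Sum>k\<le>length u. if i = j then ?a (take k u) * coord (\<xi> v) (drop k u) else 0)"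
        using snoc by (intro sum.cong) (auto simp: ket.rep_eq)
      also have "\<dots> = (if i = j then coord (T (\<xi> v)) u else 0)"
        using snoc.IH[of u] by simp
      also have "\<dots> = coord (T (\<xi> (v @ [j]))) w"
        unfolding * by (simp add: snoc right_creation.rep_eq)
      finally show ?thesis by simp
    qed
  qed
  then have "range \<xi> \<subseteq> ?M w" by blast
  moreover have "complex_vector.subspace (?M w)"
    by (auto simp: complex_vector.subspace_def clinear_0[OF lin] clinear_add[OF lin]
        clinear_scaleC[OF lin] zero_ell2.rep_eq plus_ell2.rep_eq scaleC_ell2.rep_eq
        distrib_left sum.distrib sum_distrib_left algebra_simps)
  moreover have "closed (?M w)"
  proof -
    have c: "continuous_on UNIV (\<lambda>y. coord y v)" for v :: "'a list"
      unfolding coord_eq_cinner_ket[symmetric] by (intro continuous_intros)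
    have "continuous_on UNIV (\<lambda>y. coord (T y) w)"
      unfolding coord_eq_cinner_ket[symmetric]
      by (intro continuous_intros linear_continuous_on bounded_clinear_imp_bounded_linear T(1))
    then show ?thesis
      by (intro closed_Collect_eq continuous_intros c)
  qed
  ultimately have "closure (cspan (range \<xi>)) \<subseteq> ?M w"
    by (rule closure_cspan_minimal)
  then show ?thesis using closure_span_ket by blast
qed


section \<open>Decay of the coordinates of powers\<close>

text \<open>The recursion is the convolution formula for the coordinates of \<open>T\<^sup>k\<^sup>+\<^sup>1 h\<close> with absolute values taken.\<close>

primrec decay_bound :: "('n list \<Rightarrow> real) \<Rightarrow> nat \<Rightarrow> 'n list \<Rightarrow> real" where
  "decay_bound a 0 w = 1"
| "decay_bound a (Suc k) w = (\<Sum>i\<le>length w. a (take i w) * decay_bound a k (drop i w))"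

lemma coord_left_multiplier_power_le:
  assumes "T \<in> right_creation_commutant"
  shows "cmod (coord ((T ^^ k) h) w) \<le> decay_bound (\<lambda>v. cmod (coord (T (\<xi> [])) v)) k w * norm h"
proof (induction k arbitrary: w)
  case 0
  then show ?case by (simp add: ell2_coord_le_norm)
next
  case (Suc k)
  let ?a = "\<lambda>v. coord (T (\<xi> [])) v"
  have "cmod (coord ((T ^^ Suc k) h) w)
      \<le> (\<Sum>i\<le>length w. cmod (?a (take i w) * coord ((T ^^ k) h) (drop i w)))"
    unfolding funpow.simps(2) comp_apply coord_left_multiplier[OF assms, of "(T ^^ k) h" w]
    by (rule norm_sum)
  also have "\<dots> \<le> (\<Sum>i\<le>length w. cmod (?a (take i w))
      * (decay_bound (\<lambda>v. cmod (?a v)) k (drop i w) * norm h))"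
    unfolding norm_mult by (intro sum_mono mult_left_mono Suc.IH) auto
  finally show ?case by (simp add: sum_distrib_right mult.assoc)
qed

lemma damped_recursion_tendsto_zero:
  fixes u d :: "nat \<Rightarrow> real"
  assumes r: "0 \<le> r" "r < 1" and u: "\<And>k. u (Suc k) = r * u k + d k" and d: "d \<longlonglongrightarrow> 0"
  shows "u \<longlonglongrightarrow> 0"
proof (rule LIMSEQ_I)
  fix \<epsilon> :: real assume "\<epsilon> > 0"
  then have "\<epsilon> / 2 * (1 - r) > 0" using r by simp
  then obtain N where N: "\<And>k. k \<ge> N \<Longrightarrow> \<bar>d k\<bar> < \<epsilon> / 2 * (1 - r)"
    using LIMSEQ_D[OF d] by (metis diff_zero real_norm_def)
  \<comment> \<open>The constant \<open>\<epsilon> / 2\<close> is the fixed point of \<open>s \<mapsto> r s + (\<epsilon> / 2) (1 - r)\<close>.\<close>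
  have bound: "\<bar>u (N + j)\<bar> \<le> r ^ j * \<bar>u N\<bar> + \<epsilon> / 2" for j
  proof (induction j)
    case (Suc j)
    have "\<bar>u (N + Suc j)\<bar> \<le> r * \<bar>u (N + j)\<bar> + \<bar>d (N + j)\<bar>"
      using u[of "N + j"] r by (simp add: abs_mult abs_triangle_ineq[THEN order_trans])
    also have "\<dots> \<le> r * (r ^ j * \<bar>u N\<bar> + \<epsilon> / 2) + \<epsilon> / 2 * (1 - r)"
      using N[of "N + j"] r by (intro add_mono mult_left_mono Suc.IH) auto
    finally show ?case by (simp add: field_simps)
  qed (use \<open>\<epsilon> > 0\<close> in simp)
  have "(\<lambda>j. r ^ j * \<bar>u N\<bar>) \<longlonglongrightarrow> 0"
    using r by (intro tendsto_mult_left_zero LIMSEQ_power_zero) auto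
  then obtain M where M: "\<And>j. j \<ge> M \<Longrightarrow> r ^ j * \<bar>u N\<bar> < \<epsilon> / 2"
    using LIMSEQ_D[of _ 0 "\<epsilon> / 2"] \<open>\<epsilon> > 0\<close> r by fastforce
  have "norm (u k - 0) < \<epsilon>" if "k \<ge> N + M" for k
  proof -
    have "M \<le> k - N" using that by simp
    from M[OF this] bound[of "k - N"] that show ?thesis by simp
  qed
  then show "\<exists>N. \<forall>k\<ge>N. norm (u k - 0) < \<epsilon>" by blast
qed

text \<open>Splitting off the empty prefix gives a damped recursion at \<open>w\<close> with factor \<open>a []\<close>,
  whose inhomogeneous term involves proper suffixes of \<open>w\<close> only.\<close>

lemma decay_bound_tendsto_zero:
  assumes "0 \<le> a []" "a [] < 1"
  shows "(\<lambda>k. decay_bound a k w) \<longlonglongrightarrow> 0"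
proof (induction w rule: length_induct)
  case (1 w)
  show ?case
  proof (rule damped_recursion_tendsto_zero[OF assms])
    let ?d = "\<lambda>k. \<Sum>i\<in>{1..length w}. a (take i w) * decay_bound a k (drop i w)"
    show "decay_bound a (Suc k) w = a [] * decay_bound a k w + ?d k" for k
    proof -
      have "{..length w} = insert 0 {1..length w}" by auto
      then show ?thesis by simp
    qed
    show "?d \<longlonglongrightarrow> 0"
      using 1 by (intro tendsto_null_sum tendsto_mult_right_zero) auto
  qed
qed

text \<open>The symbol has norm at most one, so a unimodular constant term leaves no room for other
  coefficients, and \<open>T\<close> is a scalar multiple of the identity.\<close>

lemma unimodular_left_multiplier_unitary:
  fixes T :: "'n list ell2 \<Rightarrow> 'n list ell2"
  assumes T: "T \<in> right_creation_commutant" "norm (T (\<xi> [])) \<le> 1"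
    and c: "cmod (coord (T (\<xi> [])) []) = 1"
  shows "unitary T"
proof -
  define c where "c = coord (T (\<xi> [])) []"
  have other: "coord (T (\<xi> [])) w = 0" if "w \<noteq> []" for w
  proof -
    have "L2_set (\<lambda>i. cmod (coord (T (\<xi> [])) i)) {[], w} \<le> 1"
      using ell2_L2_set_le_norm[of "{[], w}" "T (\<xi> [])"] T(2) by simp
    then show ?thesis
      using that c by (simp add: L2_set_def)
  qed
  have T_eq: "T y = c *\<^sub>C y" for y
  proof (rule ell2_eqI)
    fix w
    have "coord (T y) w = (\<Sum>i\<le>length w. coord (T (\<xi> [])) (take i w) * coord y (drop i w))"
      using T(1) by (rule coord_left_multiplier)
    also have "\<dots> = (\<Sum>i\<in>{0}. coord (T (\<xi> [])) (take i w) * coord y (drop i w))"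
      by (intro sum.mono_neutral_right) (auto intro!: other)
    also have "\<dots> = coord (c *\<^sub>C y) w"
      by (simp add: scaleC_ell2.rep_eq c_def)
    finally show "coord (T y) w = coord (c *\<^sub>C y) w" .
  qed
  have c1: "cmod c = 1" using c by (simp add: c_def)
  then have cc: "c * cnj c = 1"
    using complex_norm_square[of c] by simp
  have "clinear T"
    using T(1) by (simp add: right_creation_commutant_def bounded_clinear_def)
  then have "isometry T"
    by (simp add: isometry_def T_eq norm_scaleC c1)
  moreover have "T (cnj c *\<^sub>C y) = y" for y
    by (simp add: T_eq scaleC_scaleC cc scaleC_one)
  then have "surj T" by (metis surjI)
  ultimately show ?thesis by (simp add: unitary_def)
qed

theorem theorem1p3:
  fixes T :: "'n::finite list ell2 \<Rightarrow> 'n list ell2"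
    and J :: "'n list ell2 \<Rightarrow> 'k::chilbert_space"
    and V :: "'k \<Rightarrow> 'k"
  assumes "T \<in> nc_toeplitz"
    and "contraction T"
    and "\<not> unitary T"
    and "minimal_isometric_dilation T J V"
  shows "is_shift V"
proof -
  have T: "T \<in> right_creation_commutant"
    using assms(1) nc_toeplitz_subset_commutant by blast
  then have bT: "bounded_clinear T" by (simp add: right_creation_commutant_def)
  have "norm (\<xi> [] :: 'n list ell2) = 1"
    using cinner_self[of "\<xi> [] :: 'n list ell2"] norm_ge_zero[of "\<xi> [] :: 'n list ell2"]
    by (auto simp: cinner_ket power2_eq_1_iff simp del: norm_ge_zero simp flip: of_real_power)
  then have norm_T: "norm (T (\<xi> [])) \<le> 1"
    using onorm[OF bounded_clinear_imp_bounded_linear[OF bT], of "\<xi> []"] assms(2)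
    by (simp add: contraction_def)
  let ?a = "\<lambda>v. cmod (coord (T (\<xi> [])) v)"
  have "?a [] < 1"
    using unimodular_left_multiplier_unitary[OF T norm_T] assms(3)
      order_trans[OF ell2_coord_le_norm norm_T, of "[]"] by fastforce
  then have decay: "(\<lambda>k. decay_bound ?a k w) \<longlonglongrightarrow> 0" for w
    by (intro decay_bound_tendsto_zero) auto
  show ?thesis
  proof (rule dilation_is_shift[OF assms(4) _ closure_span_ket])
    show "clinear T" using bT by (simp add: bounded_clinear_def)
    fix b :: "'n list ell2" assume "b \<in> range \<xi>"
    then obtain w where "b = \<xi> w" by blast
    then show "\<exists>\<epsilon>. \<epsilon> \<longlonglongrightarrow> 0 \<and> (\<forall>k h. cmod (cinner ((T ^^ k) h) b) \<le> \<epsilon> k * norm h)"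
      using decay[of w] coord_left_multiplier_power_le[OF T, of _ _ w]
      by (intro exI[of _ "\<lambda>k. decay_bound ?a k w"]) (simp add: coord_eq_cinner_ket)
  qed
qed

end
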